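(* Let $n \ge 1$, let $F_n = K_1 \vee P_n$ be the fan graph, let $h$ be the vertex of $K_1$, and let $\sigma$ be a signature of $F_n$. Then $l(F_n,\sigma) = \lfloor\frac{n}{2}\rfloor$ if and only if $(F_n,\sigma)$ can be switched so that there are exactly $\lfloor\frac{n}{2}\rfloor$ pairwise edge-disjoint negative triangles, each of which contains exactly one negative edge, that edge being incident to $h$.
   Context: All graphs are finite, simple and undirected. A signed graph $\Sigma=(G,\sigma)$ is a graph $G$ with a signature $\sigma:E(G)\to\{+1,-1\}$. The sign of a cycle is the product of the signs of its edges; $\Sigma$ is balanced if all its cycles are positive. The frustration index $l(\Sigma)$ is the minimum number of edges whose deletion makes $\Sigma$ balanced. Switching $\Sigma$ at a vertex subset $X$ negates the signs of all edges with exactly one endpoint in $X$. $P_n$ is the path on $n$ vertices and $\vee$ denotes the join of vertex-disjoint graphs. "There are exactly $k$ pairwise edge-disjoint negative triangles" refers to a family of $k$ such triangles, $k$ being the maximum size of such a family. *)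

theory Defs
  imports Main
begin

section \<open>Finite simple graphs\<close>

record 'a graph =
  verts :: "'a set"
  edges :: "'a set set"

definition simple_graph :: "'a graph \<Rightarrow> bool" where
  "simple_graph G \<longleftrightarrow>
     finite (verts G) \<and> (\<forall>e\<in>edges G. e \<subseteq> verts G \<and> card e = 2)"

definition delete_edges :: "'a graph \<Rightarrow> 'a set set \<Rightarrow> 'a graph" where
  "delete_edges G D = \<lparr>verts = verts G, edges = edges G - D\<rparr>"

definition complete_graph :: "'a set \<Rightarrow> 'a graph" where
  "complete_graph V = \<lparr>verts = V, edges = {{u, v} |u v. u \<in> V \<and> v \<in> V \<and> u \<noteq> v}\<rparr>"

text \<open>Only meaningful when the vertex sets are disjoint.\<close>

definition graph_join :: "'a graph \<Rightarrow> 'a graph \<Rightarrow> 'a graph" where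
  "graph_join G H =
     \<lparr>verts = verts G \<union> verts H,
      edges = edges G \<union> edges H \<union> {{u, v} |u v. u \<in> verts G \<and> v \<in> verts H}\<rparr>"

text \<open>The graphs \<open>P\<^sub>n\<close> and \<open>F\<^sub>n\<close> are determined up to isomorphism only, so they are
  rendered as predicates that hold for every labelling of the vertices. The index \<open>n\<close>
  of a path counts vertices, not edges.\<close>

definition is_path :: "nat \<Rightarrow> 'a graph \<Rightarrow> bool" where
  "is_path n P \<longleftrightarrow>
     (\<exists>v. bij_betw v {..<n} (verts P) \<and> edges P = {{v i, v (Suc i)} |i. Suc i < n})"

definition is_fan :: "nat \<Rightarrow> 'a \<Rightarrow> 'a graph \<Rightarrow> bool" where
  "is_fan n h G \<longleftrightarrow>
     (\<exists>P. is_path n P \<and> h \<notin> verts P \<and> G = graph_join (complete_graph {h}) P)"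

text \<open>A cycle is represented by its edge set, traced out by a cyclic sequence of
  distinct vertices.\<close>

definition closed_edges :: "'a list \<Rightarrow> 'a set set" where
  "closed_edges vs = {{vs ! i, vs ! (Suc i mod length vs)} |i. i < length vs}"

definition cycles :: "'a graph \<Rightarrow> 'a set set set" where
  "cycles G =
     {closed_edges vs |vs. 3 \<le> length vs \<and> distinct vs \<and> closed_edges vs \<subseteq> edges G}"

definition triangles :: "'a graph \<Rightarrow> 'a set set set" where
  "triangles G = {C \<in> cycles G. card C = 3}"


section \<open>Signed graphs\<close>

text \<open>The values of a signature outside the edge set are irrelevant.\<close>

definition is_signature :: "'a graph \<Rightarrow> ('a set \<Rightarrow> int) \<Rightarrow> bool" where
  "is_signature G \<sigma> \<longleftrightarrow> (\<forall>e\<in>edges G. \<sigma> e \<in> {1, -1})"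

definition cycle_sign :: "('a set \<Rightarrow> int) \<Rightarrow> 'a set set \<Rightarrow> int" where
  "cycle_sign \<sigma> C = (\<Prod>e\<in>C. \<sigma> e)"

definition balanced :: "'a graph \<Rightarrow> ('a set \<Rightarrow> int) \<Rightarrow> bool" where
  "balanced G \<sigma> \<longleftrightarrow> (\<forall>C\<in>cycles G. cycle_sign \<sigma> C = 1)"

definition frustration_index :: "'a graph \<Rightarrow> ('a set \<Rightarrow> int) \<Rightarrow> nat" where
  "frustration_index G \<sigma> =
     (LEAST k. \<exists>D \<subseteq> edges G. card D = k \<and> balanced (delete_edges G D) \<sigma>)"

definition switch :: "('a set \<Rightarrow> int) \<Rightarrow> 'a set \<Rightarrow> 'a set \<Rightarrow> int" where
  "switch \<sigma> X e = (if card (e \<inter> X) = 1 then - \<sigma> e else \<sigma> e)"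

definition negative_triangles :: "'a graph \<Rightarrow> ('a set \<Rightarrow> int) \<Rightarrow> 'a set set set" where
  "negative_triangles G \<sigma> = {T \<in> triangles G. cycle_sign \<sigma> T = -1}"

definition negative_edges :: "('a set \<Rightarrow> int) \<Rightarrow> 'a set set \<Rightarrow> 'a set set" where
  "negative_edges \<sigma> C = {e \<in> C. \<sigma> e = -1}"

definition edge_disjoint_negative_triangles ::
    "'a graph \<Rightarrow> ('a set \<Rightarrow> int) \<Rightarrow> 'a set set set \<Rightarrow> bool" where
  "edge_disjoint_negative_triangles G \<sigma> \<T> \<longleftrightarrow>
     \<T> \<subseteq> negative_triangles G \<sigma> \<and> pairwise disjnt \<T>"

definition maximum_edge_disjoint_negative_triangles ::
    "'a graph \<Rightarrow> ('a set \<Rightarrow> int) \<Rightarrow> 'a set set set \<Rightarrow> bool" where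
  "maximum_edge_disjoint_negative_triangles G \<sigma> \<T> \<longleftrightarrow>
     edge_disjoint_negative_triangles G \<sigma> \<T> \<and>
     (\<forall>\<T>'. edge_disjoint_negative_triangles G \<sigma> \<T>' \<longrightarrow> card \<T>' \<le> card \<T>)"


section \<open>Sanity checks\<close>

lemma is_fan_simple_graph:
  assumes "is_fan n h G"
  shows "simple_graph G"
proof -
  obtain P v where h: "h \<notin> verts P" and G: "G = graph_join (complete_graph {h}) P"
    and v: "bij_betw v {..<n} (verts P)" and E: "edges P = {{v i, v (Suc i)} |i. Suc i < n}"
    using assms unfolding is_fan_def is_path_def by blast
  have fin: "finite (verts P)"
    using bij_betw_finite[OF v] by simp
  have img: "v i \<in> verts P" if "i < n" for i
    using v that by (auto simp: bij_betw_def)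
  have P2: "e \<subseteq> verts P \<and> card e = 2" if eP: "e \<in> edges P" for e
  proof -
    obtain i where e: "e = {v i, v (Suc i)}" and i: "Suc i < n"
      using eP unfolding E by blast
    have "v i \<noteq> v (Suc i)"
      using inj_on_eq_iff[OF bij_betw_imp_inj_on[OF v], of i "Suc i"] i by simp
    then show ?thesis
      using img[of i] img[of "Suc i"] e i by simp
  qed
  have S2: "{h, u} \<subseteq> insert h (verts P) \<and> card {h, u} = 2" if "u \<in> verts P" for u
    using that h by (cases "h = u") auto
  have "e \<subseteq> insert h (verts P) \<and> card e = 2" if "e \<in> edges G" for e
  proof -
    have "e \<in> edges P \<or> (\<exists>u\<in>verts P. e = {h, u})"
      using that unfolding G graph_join_def complete_graph_def by auto
    then show ?thesis
      using P2 S2 by blast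
  qed
  moreover have "verts G = insert h (verts P)"
    unfolding G graph_join_def complete_graph_def by simp
  ultimately show ?thesis
    using fin unfolding simple_graph_def by simp
qed

lemma is_fan_exists: "\<exists>G. is_fan n (0::nat) G"
proof -
  let ?P = "\<lparr>verts = Suc ` {..<n}, edges = {{Suc i, Suc (Suc i)} |i. Suc i < n}\<rparr>"
  have "is_path n ?P"
    unfolding is_path_def by (intro exI[of _ Suc]) (auto simp: bij_betw_def)
  then show ?thesis
    unfolding is_fan_def by (intro exI[of _ "graph_join (complete_graph {0}) ?P"] exI[of _ ?P]) auto
qed

end

theory Submission
  imports Defs
begin

text \<open>Cycle signs, hence negative triangles, do not change under switching, and switching
  can make every edge of the path positive; a negative triangle then has exactly one
  negative edge, which is incident to the hub. It remains to see that the frustration index of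
  a signed fan equals the maximum number of pairwise edge-disjoint negative triangles. Every
  such triangle loses an edge when the fan is made balanced, which gives one inequality. For
  the other one, scan the triangles along the path and greedily select each negative one whose
  predecessor was not selected. For every selected triangle delete the spoke it shares with
  its successor if the successor is negative too, and its path edge otherwise: the rest is
  balanced.\<close>

section \<open>Cycle signs and switching\<close>

lemma closed_edges_image:
  "closed_edges vs = (\<lambda>i. {vs ! i, vs ! (Suc i mod length vs)}) ` {..<length vs}"
  unfolding closed_edges_def by auto

text \<open>Two distinct indices with the same edge would be successors of each other modulo the
  length, which forces a length of at most 2. So edges of a cycle can be counted and multiplied by
  index.\<close>

lemma inj_on_cycle_edge:
  assumes "distinct vs" "3 \<le> length vs"
  shows "inj_on (\<lambda>i. {vs ! i, vs ! (Suc i mod length vs)}) {..<length vs}"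
proof (rule inj_onI)
  let ?m = "length vs"
  fix i j
  assume i: "i \<in> {..<?m}" and j: "j \<in> {..<?m}"
    and eq: "{vs ! i, vs ! (Suc i mod ?m)} = {vs ! j, vs ! (Suc j mod ?m)}"
  have "Suc i mod ?m < ?m" "Suc j mod ?m < ?m"
    using i by (auto intro: mod_less_divisor)
  then have "i = j \<or> (i = Suc j mod ?m \<and> Suc i mod ?m = j)"
    using eq i j assms(1) by (auto simp: doubleton_eq_iff nth_eq_iff_index_eq)
  then show "i = j"
    using i j assms(2) by (auto simp: mod_Suc split: if_splits)
qed

lemma prod_closed_edges:
  fixes f :: "'a set \<Rightarrow> int"
  assumes "distinct vs" "3 \<le> length vs"
  shows "prod f (closed_edges vs) = (\<Prod>i<length vs. f {vs ! i, vs ! (Suc i mod length vs)})"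
  unfolding closed_edges_image using prod.reindex[OF inj_on_cycle_edge[OF assms], of f] by simp

lemma bij_betw_Suc_mod: "bij_betw (\<lambda>i. Suc i mod m) {..<m} {..<m}"
proof -
  have "inj_on (\<lambda>i. Suc i mod m) {..<m}"
    by (rule inj_onI) (auto simp: mod_Suc split: if_splits)
  moreover have "(\<lambda>i. Suc i mod m) ` {..<m} \<subseteq> {..<m}"
    by (auto intro: mod_less_divisor)
  ultimately show ?thesis
    by (simp add: bij_betw_def endo_inj_surj)
qed

text \<open>Each vertex of a cycle lies on exactly two of its edges.\<close>

lemma cycle_sign_potential:
  fixes \<phi> :: "'a \<Rightarrow> int"
  assumes "C \<in> cycles G" and "\<And>x. \<phi> x * \<phi> x = 1"
  shows "cycle_sign (\<lambda>e. \<Prod>x\<in>e. \<phi> x) C = 1"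
proof -
  obtain vs where C: "C = closed_edges vs" and vs: "3 \<le> length vs" "distinct vs"
    using assms(1) unfolding cycles_def by blast
  let ?m = "length vs"
  have ne: "vs ! i \<noteq> vs ! (Suc i mod ?m)" if "i < ?m" for i
  proof -
    have "Suc i mod ?m < ?m" "i \<noteq> Suc i mod ?m"
      using that vs by (auto simp: mod_Suc)
    then show ?thesis
      using that vs(2) nth_eq_iff_index_eq by blast
  qed
  have "cycle_sign (\<lambda>e. \<Prod>x\<in>e. \<phi> x) C
      = (\<Prod>i<?m. \<phi> (vs ! i) * \<phi> (vs ! (Suc i mod ?m)))"
    unfolding cycle_sign_def C prod_closed_edges[OF vs(2,1)]
    using ne by (intro prod.cong) auto
  also have "\<dots> = (\<Prod>i<?m. \<phi> (vs ! i)) * (\<Prod>i<?m. \<phi> (vs ! (Suc i mod ?m)))"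
    by (rule prod.distrib)
  also have "(\<Prod>i<?m. \<phi> (vs ! (Suc i mod ?m))) = (\<Prod>i<?m. \<phi> (vs ! i))"
    using prod.reindex_bij_betw[OF bij_betw_Suc_mod, of "\<lambda>i. \<phi> (vs ! i)" ?m] by simp
  also have "(\<Prod>i<?m. \<phi> (vs ! i)) * (\<Prod>i<?m. \<phi> (vs ! i)) = 1"
    using assms(2) by (simp flip: prod.distrib)
  finally show ?thesis .
qed

lemma cycles_subset_edges: "C \<in> cycles G \<Longrightarrow> C \<subseteq> edges G"
  unfolding cycles_def by blast

text \<open>The certificate of balance used for fans: a signature that is the coboundary of a
  \<open>\<phi>\<close> with values 1 and -1 is positive on every cycle.\<close>

lemma balanced_potential:
  fixes \<phi> :: "'a \<Rightarrow> int"
  assumes "\<And>x. \<phi> x * \<phi> x = 1" and "\<And>e. e \<in> edges G \<Longrightarrow> \<sigma> e = (\<Prod>x\<in>e. \<phi> x)"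
  shows "balanced G \<sigma>"
  unfolding balanced_def
proof
  fix C assume C: "C \<in> cycles G"
  have "cycle_sign \<sigma> C = cycle_sign (\<lambda>e. \<Prod>x\<in>e. \<phi> x) C"
    unfolding cycle_sign_def using cycles_subset_edges[OF C] assms(2) by (intro prod.cong) auto
  then show "cycle_sign \<sigma> C = 1"
    using cycle_sign_potential[OF C assms(1)] by simp
qed

text \<open>Switching is multiplication by the coboundary of the potential that is -1 exactly on
  \<open>X\<close>; two endpoints in \<open>X\<close> cancel. This reduces invariance under
  switching to \<open>cycle_sign_potential\<close>.\<close>

lemma switch_eq_mult:
  assumes "card e = 2"
  shows "switch \<sigma> X e = \<sigma> e * (\<Prod>x\<in>e. if x \<in> X then -1 else 1)"
proof -
  obtain x y where "e = {x, y}" "x \<noteq> y"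
    using assms unfolding card_2_iff by blast
  then show ?thesis
    unfolding switch_def by (cases "x \<in> X"; cases "y \<in> X") auto
qed

lemma cycle_sign_switch:
  assumes "simple_graph G" "C \<in> cycles G"
  shows "cycle_sign (switch \<sigma> X) C = cycle_sign \<sigma> C"
proof -
  let ?\<phi> = "\<lambda>x. if x \<in> X then -1 else (1::int)"
  have "cycle_sign (switch \<sigma> X) C = (\<Prod>e\<in>C. \<sigma> e * (\<Prod>x\<in>e. ?\<phi> x))"
    unfolding cycle_sign_def
    using assms cycles_subset_edges[OF assms(2)] unfolding simple_graph_def
    by (intro prod.cong) (auto intro!: switch_eq_mult)
  also have "\<dots> = cycle_sign \<sigma> C * cycle_sign (\<lambda>e. \<Prod>x\<in>e. ?\<phi> x) C"
    unfolding cycle_sign_def by (rule prod.distrib)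
  finally show ?thesis
    using cycle_sign_potential[OF assms(2), of ?\<phi>] by simp
qed

lemma negative_triangles_switch:
  assumes "simple_graph G"
  shows "negative_triangles G (switch \<sigma> X) = negative_triangles G \<sigma>"
  unfolding negative_triangles_def triangles_def
  using cycle_sign_switch[OF assms] by auto

lemma maximum_switch:
  assumes "simple_graph G"
  shows "maximum_edge_disjoint_negative_triangles G (switch \<sigma> X) \<T> \<longleftrightarrow>
    maximum_edge_disjoint_negative_triangles G \<sigma> \<T>"
  unfolding maximum_edge_disjoint_negative_triangles_def edge_disjoint_negative_triangles_def
    negative_triangles_switch[OF assms] ..

lemma simple_graph_finite_edges:
  assumes "simple_graph G"
  shows "finite (edges G)"
proof (rule finite_subset)
  show "edges G \<subseteq> Pow (verts G)" "finite (Pow (verts G))"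
    using assms unfolding simple_graph_def by auto
qed

section \<open>Triangles as cycles on three vertices\<close>

lemma closed_edges_triangle: "closed_edges [a, b, c] = {{a, b}, {b, c}, {c, a}}"
  unfolding closed_edges_image by (simp add: lessThan_Suc insert_commute)

lemma triangleE:
  assumes "T \<in> triangles G"
  obtains a b c where "distinct [a, b, c]" "T = {{a, b}, {b, c}, {c, a}}" "T \<subseteq> edges G"
proof -
  obtain vs where T: "T = closed_edges vs" and vs: "3 \<le> length vs" "distinct vs"
    and sub: "T \<subseteq> edges G" and "card T = 3"
    using assms unfolding triangles_def cycles_def by blast
  have "length vs = 3"
    using \<open>card T = 3\<close> T card_image[OF inj_on_cycle_edge[OF vs(2,1)]]
    unfolding closed_edges_image by simp
  then obtain a b c where "vs = [a, b, c]"
    by (auto simp: length_Suc_conv numeral_3_eq_3)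
  then show ?thesis
    using that T vs(2) sub closed_edges_triangle by metis
qed

lemma card_triangle:
  assumes "distinct [a, b, c]"
  shows "card {{a, b}, {b, c}, {c, a}} = 3"
  using assms by (auto simp: card_insert_if doubleton_eq_iff)

lemma triangleI:
  assumes "distinct [a, b, c]" "{{a, b}, {b, c}, {c, a}} \<subseteq> edges G"
  shows "{{a, b}, {b, c}, {c, a}} \<in> triangles G"
proof -
  have "closed_edges [a, b, c] \<in> cycles G"
    unfolding cycles_def using assms closed_edges_triangle[of a b c]
    by (intro CollectI exI[of _ "[a, b, c]"]) auto
  then show ?thesis
    unfolding triangles_def closed_edges_triangle using card_triangle[OF assms(1)] by simp
qed

lemma cycle_sign_triangle:
  assumes "distinct [a, b, c]"
  shows "cycle_sign \<sigma> {{a, b}, {b, c}, {c, a}} = \<sigma> {a, b} * \<sigma> {b, c} * \<sigma> {c, a}"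
  using assms unfolding cycle_sign_def by (auto simp: doubleton_eq_iff)

section \<open>Packing and covering negative triangles\<close>

text \<open>Weak duality: a negative triangle missed by \<open>D\<close> would survive in the
  balanced remainder, and disjoint triangles must be hit by distinct edges of
  \<open>D\<close>.\<close>

lemma card_packing_le_card_covering:
  assumes "simple_graph G" "edge_disjoint_negative_triangles G \<sigma> \<T>"
    and "D \<subseteq> edges G" "balanced (delete_edges G D) \<sigma>"
  shows "card \<T> \<le> card D"
proof -
  have "\<exists>e. e \<in> T \<inter> D" if "T \<in> \<T>" for T
  proof (rule ccontr)
    assume "\<nexists>e. e \<in> T \<inter> D"
    moreover have "T \<in> cycles G" "cycle_sign \<sigma> T = -1"
      using that assms(2)
      unfolding edge_disjoint_negative_triangles_def negative_triangles_def triangles_def by auto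
    ultimately have "T \<in> cycles (delete_edges G D)"
      unfolding cycles_def delete_edges_def by auto
    then show False
      using assms(4) \<open>cycle_sign \<sigma> T = -1\<close> unfolding balanced_def by auto
  qed
  then obtain f where f: "\<And>T. T \<in> \<T> \<Longrightarrow> f T \<in> T \<inter> D"
    by metis
  have "inj_on f \<T>"
    using f assms(2) unfolding edge_disjoint_negative_triangles_def pairwise_def disjnt_def
    by (intro inj_onI) (metis IntD1 IntI empty_iff)
  moreover have "f ` \<T> \<subseteq> D"
    using f by auto
  moreover have "finite D"
    using assms(3) simple_graph_finite_edges[OF assms(1)] finite_subset by blast
  ultimately show ?thesis
    by (rule card_inj_on_le)
qed

text \<open>By weak duality, a packing and a covering of matching size certify each other as
  optimal.\<close>

lemma packing_eq_covering:
  assumes "simple_graph G" "edge_disjoint_negative_triangles G \<sigma> \<T>"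
    and "D \<subseteq> edges G" "balanced (delete_edges G D) \<sigma>" and "card D \<le> card \<T>"
  shows "maximum_edge_disjoint_negative_triangles G \<sigma> \<T>"
    and "frustration_index G \<sigma> = card \<T>"
proof -
  show "maximum_edge_disjoint_negative_triangles G \<sigma> \<T>"
    using assms card_packing_le_card_covering[OF assms(1) _ assms(3,4)]
    unfolding maximum_edge_disjoint_negative_triangles_def by (meson order_trans)
  have "card D = card \<T>"
    using card_packing_le_card_covering[OF assms(1-4)] assms(5) by simp
  then show "frustration_index G \<sigma> = card \<T>"
    unfolding frustration_index_def
    using assms card_packing_le_card_covering[OF assms(1,2)]
    by (intro Least_equality) auto
qed

section \<open>Fans\<close>

definition fan_labelling :: "nat \<Rightarrow> 'a \<Rightarrow> (nat \<Rightarrow> 'a) \<Rightarrow> 'a graph \<Rightarrow> bool" where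
  "fan_labelling n h v F \<longleftrightarrow>
     inj_on v {..<n} \<and> h \<notin> v ` {..<n} \<and> verts F = insert h (v ` {..<n}) \<and>
     edges F = {{v i, v (Suc i)} |i. Suc i < n} \<union> {{h, v i} |i. i < n}"

lemma is_fan_labelling:
  assumes "is_fan n h F"
  obtains v where "fan_labelling n h v F"
proof -
  obtain P v where h: "h \<notin> verts P" and F: "F = graph_join (complete_graph {h}) P"
    and v: "bij_betw v {..<n} (verts P)" and E: "edges P = {{v i, v (Suc i)} |i. Suc i < n}"
    using assms unfolding is_fan_def is_path_def by blast
  have V: "verts P = v ` {..<n}"
    using v by (simp add: bij_betw_def)
  have "fan_labelling n h v F"
    using h bij_betw_imp_inj_on[OF v] E V
    unfolding fan_labelling_def F graph_join_def complete_graph_def by auto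
  then show ?thesis
    by (rule that)
qed

section \<open>A greedy packing and a covering that is no larger\<close>

primrec greedy :: "(nat \<Rightarrow> bool) \<Rightarrow> nat \<Rightarrow> bool" where
  "greedy N 0 = N 0"
| "greedy N (Suc i) = (N (Suc i) \<and> \<not> greedy N i)"

lemma greedy_imp: "greedy N i \<Longrightarrow> N i"
  by (cases i) auto

lemma fan_packing_covering:
  assumes F: "fan_labelling n h v F" and \<sigma>: "is_signature F \<sigma>"
  obtains \<T> D where "edge_disjoint_negative_triangles F \<sigma> \<T>"
    "D \<subseteq> edges F" "balanced (delete_edges F D) \<sigma>" "card D \<le> card \<T>"
proof -
  have inj: "v i = v j \<longleftrightarrow> i = j" if "i < n" "j < n" for i j
    using F that inj_on_eq_iff[of v "{..<n}" i j] unfolding fan_labelling_def by simp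
  have hv: "v i \<noteq> h" if "i < n" for i
    using F that unfolding fan_labelling_def by force
  have edges: "edges F = {{v i, v (Suc i)} |i. Suc i < n} \<union> {{h, v i} |i. i < n}"
    using F unfolding fan_labelling_def by blast
  define s where "s i = \<sigma> {h, v i}" for i
  define p where "p i = \<sigma> {v i, v (Suc i)}" for i
  have s: "s i = 1 \<or> s i = -1" if "i < n" for i
    using that \<sigma> unfolding is_signature_def edges s_def by blast
  have p: "p i = 1 \<or> p i = -1" if "Suc i < n" for i
    using that \<sigma> unfolding is_signature_def edges p_def by blast
  \<comment> \<open>The triangle on \<open>h\<close>, \<open>v i\<close>, \<open>v (Suc i)\<close>
    exists and is negative. The guard makes \<open>N\<close> false beyond the last triangle.\<close>
  define N where "N i \<longleftrightarrow> Suc i < n \<and> s i * p i * s (Suc i) = -1" for i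
  \<comment> \<open>In each maximal run of consecutive negative triangles, the first, third, fifth
    and so on are selected.\<close>
  define I where "I = {i. greedy N i}"
  have I: "N i" if "i \<in> I" for i
    using that greedy_imp unfolding I_def by auto
  then have I_less: "Suc i < n" if "i \<in> I" for i
    using that unfolding N_def by auto
  have "I \<subseteq> {..<n}"
    using I_less by (auto dest: Suc_lessD)
  then have finI: "finite I"
    by (rule finite_subset) simp
  have I_step: "Suc i \<notin> I" if "i \<in> I" for i
    using that unfolding I_def by simp
  define t where "t i = {{h, v i}, {v i, v (Suc i)}, {v (Suc i), h}}" for i
  have dist: "distinct [h, v i, v (Suc i)]" if "Suc i < n" for i
    using that inj[of i "Suc i"] hv[of i] hv[of "Suc i"] by auto
  have t_neg: "t i \<in> negative_triangles F \<sigma>" if "i \<in> I" for i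
  proof -
    have i: "Suc i < n"
      using I_less that .
    have "{v (Suc i), h} \<in> edges F"
      using i unfolding edges by (auto simp: insert_commute)
    moreover have "{h, v i} \<in> edges F" "{v i, v (Suc i)} \<in> edges F"
      using i unfolding edges by (auto dest: Suc_lessD)
    ultimately have "t i \<in> triangles F"
      unfolding t_def by (intro triangleI[OF dist[OF i]]) auto
    moreover have "cycle_sign \<sigma> (t i) = s i * p i * s (Suc i)"
      unfolding t_def cycle_sign_triangle[OF dist[OF i]] s_def p_def
      by (simp add: insert_commute)
    ultimately show ?thesis
      using I[OF that] unfolding negative_triangles_def N_def by simp
  qed
  have t_disj: "disjnt (t i) (t j)" if "i \<in> I" "j \<in> I" "i \<noteq> j" for i j
  proof -
    \<comment> \<open>Different triangles share an edge only when their indices are consecutive,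
      namely the spoke between them.\<close>
    have "j \<noteq> Suc i" "i \<noteq> Suc j"
      using that I_step by auto
    moreover have "Suc i < n" "Suc j < n" "i < n" "j < n"
      using that I_less by (auto dest: Suc_lessD)
    ultimately show ?thesis
      using that(3) hv[of i] hv[of j] hv[of "Suc i"] hv[of "Suc j"]
      unfolding t_def disjnt_def by (auto simp: doubleton_eq_iff inj)
  qed
  have "inj_on t I"
  proof (rule inj_onI, rule ccontr)
    fix i j assume "i \<in> I" "j \<in> I" "t i = t j" "i \<noteq> j"
    then have "disjnt (t i) (t i)"
      using t_disj[of i j] by simp
    then show False
      unfolding t_def by simp
  qed
  then have card_t: "card (t ` I) = card I"
    by (rule card_image)
  have packing: "edge_disjoint_negative_triangles F \<sigma> (t ` I)"
    unfolding edge_disjoint_negative_triangles_def pairwise_def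
    using t_neg t_disj by blast
  define g where "g i = (if N (Suc i) then {h, v (Suc i)} else {v i, v (Suc i)})" for i
  \<comment> \<open>\<open>flip i\<close> marks the deleted spokes \<open>{h, v i}\<close>. There
    the potential is minus the spoke sign; on every kept spoke it equals that sign, as
    \<open>h\<close> gets the value 1.\<close>
  define flip where "flip i \<longleftrightarrow> (\<exists>j\<in>I. i = Suc j \<and> N i)" for i
  define f where "f i = (if flip i then - s i else s i)" for i
  define \<phi> where "\<phi> x = (if x \<in> v ` {..<n} then f (the_inv_into {..<n} v x) else 1)" for x
  have injv: "inj_on v {..<n}" and h: "h \<notin> v ` {..<n}"
    using F unfolding fan_labelling_def by auto
  have \<phi>_v: "\<phi> (v i) = f i" if "i < n" for i
    unfolding \<phi>_def using that the_inv_into_f_f[OF injv] by auto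
  have \<phi>_h: "\<phi> h = 1"
    unfolding \<phi>_def using h by simp
  have f: "f i = 1 \<or> f i = -1" if "i < n" for i
    using s[OF that] unfolding f_def by auto
  have \<phi>_sq: "\<phi> x * \<phi> x = 1" for x
  proof (cases "x \<in> v ` {..<n}")
    case True
    then obtain i where "i < n" "x = v i" by auto
    then show ?thesis
      using f[of i] \<phi>_v by auto
  qed (simp add: \<phi>_def)
  have spoke: "{h, v i} \<in> g ` I" if "flip i" for i
    using that unfolding flip_def g_def by force
  have path: "{v i, v (Suc i)} \<in> g ` I \<or> p i = f i * f (Suc i)" if i: "Suc i < n" for i
  proof -
    \<comment> \<open>At most one spoke of a triangle is deleted, and then the triangle is negative.
      The single sign change in \<open>f\<close> therefore makes its path edge agree with the
      potential.\<close>
    have cases: "flip i \<Longrightarrow> N i \<and> \<not> flip (Suc i)" "flip (Suc i) \<Longrightarrow> N i"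
      unfolding flip_def using I I_step by auto
    \<comment> \<open>A negative triangle is skipped only when its predecessor was selected, and
      then the spoke they share is deleted.\<close>
    have sel: "i \<in> I" if "N i" "\<not> flip i"
      using that unfolding flip_def I_def by (cases i) auto
    \<comment> \<open>Such a triangle is selected, and its successor is not negative, since
      otherwise \<open>flip (Suc i)\<close> would hold. Hence \<open>g i\<close> is the path
      edge.\<close>
    have "{v i, v (Suc i)} \<in> g ` I" if "N i" "\<not> flip i" "\<not> flip (Suc i)"
    proof -
      have "i \<in> I" "\<not> N (Suc i)"
        using sel that unfolding flip_def by auto
      then show ?thesis
        unfolding g_def by force
    qed
    then show ?thesis
      using cases s[of i] s[of "Suc i"] p[OF i] i unfolding N_def f_def by auto
  qed
  have bal: "balanced (delete_edges F (g ` I)) \<sigma>"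
  proof (rule balanced_potential[OF \<phi>_sq])
    fix e assume "e \<in> edges (delete_edges F (g ` I))"
    then have e: "e \<in> edges F" "e \<notin> g ` I"
      unfolding delete_edges_def by auto
    from e(1) consider i where "Suc i < n" "e = {v i, v (Suc i)}" | i where "i < n" "e = {h, v i}"
      unfolding edges by blast
    then show "\<sigma> e = (\<Prod>x\<in>e. \<phi> x)"
    proof cases
      case (1 i)
      then show ?thesis
        using path[of i] e(2) inj[of i "Suc i"] \<phi>_v[of i] \<phi>_v[of "Suc i"] p_def by simp
    next
      case (2 i)
      then have "\<not> flip i"
        using spoke e(2) by blast
      then show ?thesis
        using 2 \<phi>_v[of i] \<phi>_h hv[of i] unfolding f_def s_def by simp
    qed
  qed
  have "g ` I \<subseteq> edges F"
    using I_less unfolding g_def edges by auto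
  then show ?thesis
    using that[OF packing _ bal] card_image_le[OF finI, of g] card_t by simp
qed

section \<open>Making the path positive by switching\<close>

lemma fan_switch_path_positive:
  assumes F: "fan_labelling n h v F" and \<sigma>: "is_signature F \<sigma>"
  obtains X where "X \<subseteq> verts F" "\<And>i. Suc i < n \<Longrightarrow> switch \<sigma> X {v i, v (Suc i)} = 1"
proof -
  \<comment> \<open>The sign of the path from \<open>v 0\<close> to \<open>v i\<close>. Switching
    where it is -1 multiplies each path edge by \<open>q i * q (Suc i)\<close>, which is the sign of
    that edge.\<close>
  define q where "q i = (\<Prod>j<i. \<sigma> {v j, v (Suc j)})" for i
  have p: "\<sigma> {v i, v (Suc i)} = 1 \<or> \<sigma> {v i, v (Suc i)} = -1" if "Suc i < n" for i
    using that F \<sigma> unfolding is_signature_def fan_labelling_def by blast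
  have q: "q i = 1 \<or> q i = -1" if "i < n" for i
    using that
  proof (induction i)
    case (Suc i)
    then show ?case
      using p[of i] unfolding q_def by auto
  qed (simp add: q_def)
  have inj: "v i = v j \<longleftrightarrow> i = j" if "i < n" "j < n" for i j
    using F that inj_on_eq_iff[of v "{..<n}" i j] unfolding fan_labelling_def by simp
  define X where "X = {v i |i. i < n \<and> q i = -1}"
  have X: "v i \<in> X \<longleftrightarrow> q i = -1" if "i < n" for i
    unfolding X_def using inj that by auto
  have "switch \<sigma> X {v i, v (Suc i)} = 1" if i: "Suc i < n" for i
  proof -
    have ne: "v i \<noteq> v (Suc i)"
      using inj[of i "Suc i"] i by simp
    have "switch \<sigma> X {v i, v (Suc i)}
        = \<sigma> {v i, v (Suc i)} * (\<Prod>x\<in>{v i, v (Suc i)}. if x \<in> X then -1 else 1)"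
      using ne by (intro switch_eq_mult) simp
    also have "\<dots> = \<sigma> {v i, v (Suc i)} * (q i * q (Suc i))"
      using ne X[of i] X[of "Suc i"] q[of i] q[of "Suc i"] i by auto
    also have "\<dots> = 1"
      using p[OF i] q[of i] i unfolding q_def by auto
    finally show ?thesis .
  qed
  moreover have "X \<subseteq> verts F"
    using F unfolding X_def fan_labelling_def by auto
  ultimately show ?thesis
    using that by blast
qed

text \<open>A triangle avoiding \<open>h\<close> has only positive edges, so a negative one contains
  \<open>h\<close>. Its edge opposite \<open>h\<close> is positive, hence exactly one of its two
  spokes is negative.\<close>

lemma negative_triangle_one_negative_spoke:
  assumes F: "fan_labelling n h v F" and \<tau>: "is_signature F \<tau>"
    and pos: "\<And>i. Suc i < n \<Longrightarrow> \<tau> {v i, v (Suc i)} = 1"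
    and T: "T \<in> negative_triangles F \<tau>"
  shows "\<exists>e. negative_edges \<tau> T = {e} \<and> h \<in> e"
proof -
  have pos_edge: "\<tau> e = 1" if "e \<in> edges F" "h \<notin> e" for e
    using that F pos unfolding fan_labelling_def by auto
  \<comment> \<open>The case with \<open>h\<close> listed first; the other positions of
    \<open>h\<close> follow by rotating the triangle.\<close>
  have key: ?thesis if abc: "distinct [h, b, c]" "T = {{h, b}, {b, c}, {c, h}}" "T \<subseteq> edges F"
    for b c
  proof -
    have "\<tau> {b, c} = 1"
      using abc by (intro pos_edge) auto
    moreover have "\<tau> {h, b} * \<tau> {b, c} * \<tau> {c, h} = -1"
      using T cycle_sign_triangle[OF abc(1), of \<tau>] abc(2) unfolding negative_triangles_def by simp
    moreover have "\<tau> {h, b} = 1 \<or> \<tau> {h, b} = -1" "\<tau> {c, h} = 1 \<or> \<tau> {c, h} = -1"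
      using \<tau> abc unfolding is_signature_def by auto
    ultimately have "negative_edges \<tau> T = {{h, b}} \<or> negative_edges \<tau> T = {{c, h}}"
      unfolding negative_edges_def abc(2) by auto
    then show ?thesis
      by auto
  qed
  obtain a b c where abc: "distinct [a, b, c]" "T = {{a, b}, {b, c}, {c, a}}" "T \<subseteq> edges F"
    using T triangleE unfolding negative_triangles_def by blast
  have "h \<in> {a, b, c}"
  proof (rule ccontr)
    assume "h \<notin> {a, b, c}"
    then have "\<tau> {a, b} = 1" "\<tau> {b, c} = 1" "\<tau> {c, a} = 1"
      using abc by (auto intro!: pos_edge)
    then show False
      using T cycle_sign_triangle[OF abc(1), of \<tau>] abc(2) unfolding negative_triangles_def by simp
  qed
  then consider "h = a" | "h = b" | "h = c"
    by auto
  then show ?thesis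
  proof cases
    case 1
    then show ?thesis using key[of b c] abc by simp
  next
    case 2
    then show ?thesis using key[of c a] abc by (auto simp: insert_commute)
  next
    case 3
    then show ?thesis using key[of a b] abc by (auto simp: insert_commute)
  qed
qed

lemma is_signature_switch: "is_signature G \<sigma> \<Longrightarrow> is_signature G (switch \<sigma> X)"
  unfolding is_signature_def switch_def by auto

theorem corollary20:
  fixes n :: nat and h :: 'a and F :: "'a graph" and \<sigma> :: "'a set \<Rightarrow> int"
  assumes "n \<ge> 1"
    and "is_fan n h F"
    and "is_signature F \<sigma>"
  shows "frustration_index F \<sigma> = n div 2 \<longleftrightarrow>
    (\<exists>X \<subseteq> verts F. \<exists>\<T>.
       maximum_edge_disjoint_negative_triangles F (switch \<sigma> X) \<T> \<and>
       card \<T> = n div 2 \<and>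
       (\<forall>T\<in>\<T>. \<exists>e. negative_edges (switch \<sigma> X) T = {e} \<and> h \<in> e))"
proof -
  obtain v where v: "fan_labelling n h v F"
    using is_fan_labelling[OF assms(2)] .
  have G: "simple_graph F"
    using is_fan_simple_graph[OF assms(2)] .
  obtain \<T> D where "edge_disjoint_negative_triangles F \<sigma> \<T>"
    "D \<subseteq> edges F" "balanced (delete_edges F D) \<sigma>" "card D \<le> card \<T>"
    using fan_packing_covering[OF v assms(3)] .
  note max = packing_eq_covering[OF G this]
  obtain X where X: "X \<subseteq> verts F" "\<And>i. Suc i < n \<Longrightarrow> switch \<sigma> X {v i, v (Suc i)} = 1"
    using fan_switch_path_positive[OF v assms(3)] by blast
  have "\<T> \<subseteq> negative_triangles F (switch \<sigma> X)"
    using max(1) unfolding negative_triangles_switch[OF G]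
      maximum_edge_disjoint_negative_triangles_def edge_disjoint_negative_triangles_def by blast
  then have one: "\<exists>e. negative_edges (switch \<sigma> X) T = {e} \<and> h \<in> e" if "T \<in> \<T>" for T
    using that negative_triangle_one_negative_spoke[OF v is_signature_switch[OF assms(3)] X(2)]
    by blast
  \<comment> \<open>For the backward direction: a maximum family for any switching is maximum for
    \<open>\<sigma>\<close> by \<open>maximum_switch\<close>, so its size is that of
    \<open>\<T>\<close>, which is the frustration index.\<close>
  have "card \<T>' = card \<T>" if "maximum_edge_disjoint_negative_triangles F \<sigma> \<T>'" for \<T>'
    using that max(1) unfolding maximum_edge_disjoint_negative_triangles_def
    by (meson order_antisym)
  then show ?thesis
    unfolding maximum_switch[OF G] max(2) using X(1) one max(1) by metis
qed

end
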